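(* Let $d\ge 8$ and $n\ge 1$. Let $B^0,\dots,B^{n-1}$ be $n$ vertex-disjoint copies of $K_{d-2}$, the vertices of $B^i$ being labelled $a^i_1,\dots,a^i_{d-2}$, and connect consecutive bays by making $a^i_j$ adjacent to $a^{i-1}_{d-1-j}$ for all $0\le i\le n-1$ and $1\le j\le\lceil (d-2)/2\rceil$, superscripts taken mod $n$. Let $P^5_d$ be the graph obtained from $K_{d+1}$ by deleting the edges of two paths of length 2 and a 3-cycle (pairwise vertex-disjoint) and then deleting a maximum matching on the $d-8$ remaining vertices; its vertices of degree $d-2$ are the two middle vertices of the paths and the three vertices of the 3-cycle. Let $H^5_d$ be obtained by adding pairwise vertex-disjoint copies of $P^5_d$, where for each copy one edge is added from each of its five vertices of degree $d-2$ to a vertex of a single bay $B^i$ (the same bay for all five edges), there are no edges between distinct copies, and enough copies are added so that every vertex of every $B^i$ has degree at least $d-1$. Then $H^5_d$ has minimum degree $d-1$ and has no immersion of $K_d$.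
   Context: All graphs are simple. A graph $H$ is immersed in a graph $G$ if there is an injection $\phi:V(H)\to V(G)$ and an assignment to each edge $uv\in E(H)$ of a path in $G$ between $\phi(u)$ and $\phi(v)$ with paths of distinct edges pairwise edge-disjoint. *)

theory Defs
  imports Complex_Main
begin

text \<open>
  A simple graph is a pair of a vertex set and a set of edges, the edges being two-element
  sets of vertices. All graphs built below from \<open>complete_graph\<close> are of this kind.
\<close>

type_synonym 'a graph = "'a set \<times> 'a set set"

abbreviation verts :: "'a graph \<Rightarrow> 'a set" where
  "verts G \<equiv> fst G"

abbreviation edges :: "'a graph \<Rightarrow> 'a set set" where
  "edges G \<equiv> snd G"

definition complete_graph :: "'a set \<Rightarrow> 'a graph" where
  "complete_graph V = (V, {{u, v} | u v. u \<in> V \<and> v \<in> V \<and> u \<noteq> v})"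

definition delete_edges :: "'a graph \<Rightarrow> 'a set set \<Rightarrow> 'a graph" where
  "delete_edges G D = (verts G, edges G - D)"

definition degree :: "'a graph \<Rightarrow> 'a \<Rightarrow> nat" where
  "degree G v = card {e \<in> edges G. v \<in> e}"

definition min_degree :: "'a graph \<Rightarrow> nat" where
  "min_degree G = Min (degree G ` verts G)"

definition matching :: "'a graph \<Rightarrow> 'a set set \<Rightarrow> bool" where
  "matching G M \<longleftrightarrow> M \<subseteq> edges G \<and> pairwise disjnt M"

definition maximum_matching :: "'a graph \<Rightarrow> 'a set set \<Rightarrow> bool" where
  "maximum_matching G M \<longleftrightarrow> matching G M \<and> (\<forall>M'. matching G M' \<longrightarrow> card M' \<le> card M)"

fun path_edges :: "'a list \<Rightarrow> 'a set set" where
  "path_edges (x # y # xs) = insert {x, y} (path_edges (y # xs))"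
| "path_edges _ = {}"

text \<open>
  Graphs are undirected, so a path between \<open>x\<close> and \<open>y\<close> may be listed from either end.
\<close>

definition path_between :: "'a graph \<Rightarrow> 'a \<Rightarrow> 'a \<Rightarrow> 'a list \<Rightarrow> bool" where
  "path_between G x y p \<longleftrightarrow>
     p \<noteq> [] \<and> distinct p \<and> set p \<subseteq> verts G \<and> path_edges p \<subseteq> edges G \<and>
     (hd p = x \<and> last p = y \<or> hd p = y \<and> last p = x)"

definition immersed :: "'b graph \<Rightarrow> 'a graph \<Rightarrow> bool" where
  "immersed H G \<longleftrightarrow>
     (\<exists>\<phi> p. inj_on \<phi> (verts H) \<and> \<phi> ` verts H \<subseteq> verts G \<and>
        (\<forall>u v. {u, v} \<in> edges H \<longrightarrow> path_between G (\<phi> u) (\<phi> v) (p {u, v})) \<and>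
        (\<forall>e\<in>edges H. \<forall>f\<in>edges H. e \<noteq> f \<longrightarrow> path_edges (p e) \<inter> path_edges (p f) = {}))"

text \<open>
  \<open>is_P5 d P\<close>: the graph \<open>P\<close> is a copy of \<open>P\<^sup>5\<^sub>d\<close>. The deleted paths of length 2 are
  \<open>x y z\<close> and \<open>x' y' z'\<close>, the deleted 3-cycle is \<open>t u v\<close>, and \<open>M\<close> is the deleted matching.
\<close>

definition is_P5 :: "nat \<Rightarrow> 'a graph \<Rightarrow> bool" where
  "is_P5 d P \<longleftrightarrow>
     finite (verts P) \<and> card (verts P) = d + 1 \<and>
     (\<exists>x y z x' y' z' t u v M.
        distinct [x, y, z, x', y', z', t, u, v] \<and>
        set [x, y, z, x', y', z', t, u, v] \<subseteq> verts P \<and>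
        maximum_matching
          (complete_graph (verts P - set [x, y, z, x', y', z', t, u, v])) M \<and>
        P = delete_edges (complete_graph (verts P))
              (path_edges [x, y, z] \<union> path_edges [x', y', z'] \<union> path_edges [t, u, v, t] \<union> M))"

definition low_verts :: "nat \<Rightarrow> 'a graph \<Rightarrow> 'a set" where
  "low_verts d P = {w \<in> verts P. degree P w = d - 2}"

definition bay :: "nat \<Rightarrow> (nat \<Rightarrow> nat \<Rightarrow> 'a) \<Rightarrow> nat \<Rightarrow> 'a set" where
  "bay d a i = a i ` {1..d - 2}"

text \<open>
  The edges between consecutive bays; \<open>(i + n - 1) mod n\<close> is \<open>i - 1\<close> modulo \<open>n\<close>.
  The condition that the ends be distinct matters only for \<open>n = 1\<close> and odd \<open>d\<close>, where the
  rule would join \<open>a 0 ((d - 1) div 2)\<close> to itself: graphs being simple, there is no loop. Likewise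
  coinciding edges (for \<open>n \<le> 2\<close>) are counted once.
\<close>

definition bay_links :: "nat \<Rightarrow> nat \<Rightarrow> (nat \<Rightarrow> nat \<Rightarrow> 'a) \<Rightarrow> 'a set set" where
  "bay_links d n a =
     {{a i j, a ((i + n - 1) mod n) (d - 1 - j)} | i j.
        i < n \<and> 1 \<le> j \<and> int j \<le> \<lceil>(real d - 2) / 2\<rceil> \<and>
        a i j \<noteq> a ((i + n - 1) mod n) (d - 1 - j)}"

text \<open>
  \<open>is_H5 d n H\<close>: the graph \<open>H\<close> is one of the graphs \<open>H\<^sup>5\<^sub>d\<close> with \<open>n\<close> bays. Here \<open>a i j\<close> is the
  vertex \<open>a\<^sup>i\<^sub>j\<close>, \<open>\<C>\<close> is the set of added copies of \<open>P\<^sup>5\<^sub>d\<close>, and \<open>f w\<close> is the bay vertex to which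
  the vertex \<open>w\<close> of degree \<open>d - 2\<close> of a copy is joined; \<open>f\<close> need not be injective.
\<close>

definition is_H5 :: "nat \<Rightarrow> nat \<Rightarrow> 'a graph \<Rightarrow> bool" where
  "is_H5 d n H \<longleftrightarrow>
     (\<exists>a \<C> f.
        inj_on (\<lambda>(i, j). a i j) ({..<n} \<times> {1..d - 2}) \<and>
        finite \<C> \<and>
        (\<forall>P\<in>\<C>. is_P5 d P) \<and>
        (\<forall>P\<in>\<C>. \<forall>Q\<in>\<C>. P \<noteq> Q \<longrightarrow> verts P \<inter> verts Q = {}) \<and>
        (\<forall>P\<in>\<C>. \<forall>i<n. verts P \<inter> bay d a i = {}) \<and>
        (\<forall>P\<in>\<C>. \<exists>i<n. \<forall>w\<in>low_verts d P. f w \<in> bay d a i) \<and>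
        verts H = (\<Union>i<n. bay d a i) \<union> (\<Union>P\<in>\<C>. verts P) \<and>
        edges H = (\<Union>i<n. edges (complete_graph (bay d a i))) \<union> bay_links d n a \<union>
                  (\<Union>P\<in>\<C>. edges P \<union> {{w, f w} | w. w \<in> low_verts d P}) \<and>
        (\<forall>i<n. \<forall>x\<in>bay d a i. d - 1 \<le> degree H x))"

end

theory Submission
  imports Defs
begin

text \<open>
  A cut with \<open>s\<close> branch vertices on one side is crossed by at least \<open>s (d - s)\<close> of the edge-disjoint
  paths. A copy of \<open>P\<^sup>5\<^sub>d\<close> is separated from the rest by 5 edges, fewer than \<open>d - 1\<close>, so a copy
  containing one branch vertex contains them all; this is excluded by counting degrees and the
  parity of the number of times paths leave the copy. Otherwise all branch vertices lie in bays.
  An arc of bays is separated by at most \<open>d - 1\<close> edges, hence contains at most one branch vertex or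
  all but at most one; a single bay, having \<open>d - 2\<close> vertices, contains at most one. So an arc growing
  bay by bay from the empty one never reaches a second branch vertex.
\<close>

section \<open>Edges of complete graphs\<close>

lemma verts_complete_graph [simp]: "verts (complete_graph V) = V"
  by (simp add: complete_graph_def)

lemma edges_complete_graph_iff:
  "e \<in> edges (complete_graph V) \<longleftrightarrow> (\<exists>u\<in>V. \<exists>v\<in>V. u \<noteq> v \<and> e = {u, v})"
  by (auto simp: complete_graph_def)

lemma complete_graph_edgeD: "e \<in> edges (complete_graph V) \<Longrightarrow> e \<subseteq> V"
  by (auto simp: edges_complete_graph_iff)

lemma finite_complete_graph_edges: "finite V \<Longrightarrow> finite (edges (complete_graph V))"
  by (rule finite_subset[of _ "Pow V"]) (use complete_graph_edgeD in blast, simp)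

section \<open>Paths\<close>

lemma path_edges_subset: "e \<in> path_edges p \<Longrightarrow> e \<subseteq> set p"
  by (induction p rule: path_edges.induct) auto

lemma finite_path_edges [simp]: "finite (path_edges p)"
  by (induction p rule: path_edges.induct) auto

lemma path_edges_snoc: "path_edges (xs @ [x, y]) = insert {x, y} (path_edges (xs @ [x]))"
  by (induction xs rule: path_edges.induct) auto

lemma path_edges_rev [simp]: "path_edges (rev p) = path_edges p"
proof (induction p rule: path_edges.induct)
  case (1 x y xs)
  then show ?case
    using path_edges_snoc[of "rev xs" y x] by (simp add: insert_commute)
qed auto

text \<open>Each crossing edge switches sides, so only the parity of the number of switches matters
  for the two ends. Distinctness keeps the steps of the path different as edges; otherwise a set of
  edges would not count switches.\<close>

lemma even_card_path_crossings:
  assumes "distinct p" "p \<noteq> []"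
  shows "even (card {e \<in> path_edges p. e \<inter> S \<noteq> {} \<and> \<not> e \<subseteq> S}) \<longleftrightarrow> (hd p \<in> S \<longleftrightarrow> last p \<in> S)"
  using assms
proof (induction p rule: path_edges.induct)
  case (1 x y xs)
  let ?C = "{e \<in> path_edges (y # xs). e \<inter> S \<noteq> {} \<and> \<not> e \<subseteq> S}"
  have IH: "even (card ?C) \<longleftrightarrow> (y \<in> S \<longleftrightarrow> last (y # xs) \<in> S)"
    using 1 by simp
  have notin: "{x, y} \<notin> ?C"
    using 1(2) path_edges_subset[of "{x, y}" "y # xs"] by auto
  have eq: "{e \<in> path_edges (x # y # xs). e \<inter> S \<noteq> {} \<and> \<not> e \<subseteq> S} =
    (if (x \<in> S) = (y \<in> S) then ?C else insert {x, y} ?C)"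
    by auto
  have "finite ?C"
    by simp
  then have "card (insert {x, y} ?C) = Suc (card ?C)"
    using notin by (rule card_insert_disjoint)
  then show ?case
    unfolding eq using IH by auto
qed auto

lemma path_edge_at_vertex:
  assumes "2 \<le> length p" "x \<in> set p"
  shows "\<exists>e\<in>path_edges p. x \<in> e"
  using assms
proof (induction p rule: path_edges.induct)
  case (1 a b xs)
  then show ?case by (cases xs) auto
qed auto

text \<open>The first vertex does not recur in the tail, so only the first edge contains it;
  reversing the list handles the last vertex.\<close>

lemma path_edge_at_end_unique:
  assumes "distinct p" "x = hd p \<or> x = last p" "e \<in> path_edges p" "e' \<in> path_edges p"
    "x \<in> e" "x \<in> e'"
  shows "e = e'"
proof -
  have *: "e = e'" if "distinct p" "x = hd p" "e \<in> path_edges p" "e' \<in> path_edges p" for p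
  proof (cases p rule: path_edges.cases)
    case (1 x' y xs)
    have "x \<notin> h" if "h \<in> path_edges (y # xs)" for h
      using path_edges_subset[OF that] \<open>distinct p\<close> \<open>x = hd p\<close> 1 by auto
    then show ?thesis
      using that(3,4) assms(5,6) 1 by auto
  qed (use that in auto)
  show ?thesis
    using assms *[of p] *[of "rev p"] by (auto simp: hd_rev)
qed

text \<open>The crossing parity is applied to the set \<open>{x}\<close>: both ends lie outside, so
  the number of edges at \<open>x\<close> is even, and it is not zero.\<close>

lemma path_inner_vertex_edges:
  assumes "distinct p" "x \<in> set p" "x \<noteq> hd p" "x \<noteq> last p"
  shows "2 \<le> card {e \<in> path_edges p. x \<in> e}"
proof -
  have proper: "\<not> e \<subseteq> {x}" if "e \<in> path_edges p" for e
    using \<open>distinct p\<close> that by (induction p rule: path_edges.induct) auto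
  have eq: "{e \<in> path_edges p. e \<inter> {x} \<noteq> {} \<and> \<not> e \<subseteq> {x}} = {e \<in> path_edges p. x \<in> e}"
    using proper by auto
  have "p \<noteq> []"
    using assms(2) by auto
  then have "even (card {e \<in> path_edges p. x \<in> e})"
    using even_card_path_crossings[OF assms(1), of "{x}"] assms(3,4) unfolding eq by simp
  moreover obtain a q where p: "p = a # q"
    using assms(2) by (cases p) auto
  then have "q \<noteq> []"
    using assms(2,3) by auto
  then have "2 \<le> length p"
    using p by (cases q) auto
  then have "{e \<in> path_edges p. x \<in> e} \<noteq> {}"
    using path_edge_at_vertex[OF _ assms(2)] by auto
  then have "card {e \<in> path_edges p. x \<in> e} \<noteq> 0"
    by simp
  ultimately show ?thesis
    by presburger
qed

section \<open>Immersions of complete graphs\<close>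

definition boundary :: "'a graph \<Rightarrow> 'a set \<Rightarrow> 'a set set" where
  "boundary G S = {e \<in> edges G. e \<inter> S \<noteq> {} \<and> \<not> e \<subseteq> S}"

text \<open>Here \<open>X\<close> is the set of branch vertices in \<open>G\<close> itself, and
  \<open>Q\<close> is indexed by pairs of them, so the injection disappears. Edge-disjointness is
  stated contrapositively: a common edge identifies the pair.\<close>

locale clique_immersion =
  fixes G :: "'a graph" and X :: "'a set" and Q :: "'a set \<Rightarrow> 'a list"
  assumes finite_edges: "finite (edges G)"
    and finite_branch: "finite X"
    and path: "\<lbrakk>u \<in> X; v \<in> X; u \<noteq> v\<rbrakk> \<Longrightarrow> path_between G u v (Q {u, v})"
    and path_unique: "\<lbrakk>u \<in> X; v \<in> X; u \<noteq> v; u' \<in> X; v' \<in> X; u' \<noteq> v';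
      e \<in> path_edges (Q {u, v}); e \<in> path_edges (Q {u', v'})\<rbrakk> \<Longrightarrow> {u, v} = {u', v'}"
begin

lemma path_props:
  assumes "u \<in> X" "v \<in> X" "u \<noteq> v"
  shows "distinct (Q {u, v})" "Q {u, v} \<noteq> []" "path_edges (Q {u, v}) \<subseteq> edges G"
    "hd (Q {u, v}) = u \<and> last (Q {u, v}) = v \<or> hd (Q {u, v}) = v \<and> last (Q {u, v}) = u"
    "2 \<le> length (Q {u, v})" "u \<in> set (Q {u, v})"
proof -
  show *: "distinct (Q {u, v})" "Q {u, v} \<noteq> []" "path_edges (Q {u, v}) \<subseteq> edges G"
    "hd (Q {u, v}) = u \<and> last (Q {u, v}) = v \<or> hd (Q {u, v}) = v \<and> last (Q {u, v}) = u"
    using path[OF assms] unfolding path_between_def by auto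
  show "2 \<le> length (Q {u, v})"
    using * assms(3) by (cases "Q {u, v}" rule: path_edges.cases) auto
  show "u \<in> set (Q {u, v})"
    using *(2,4) by (metis hd_in_set last_in_set)
qed

lemma boundary_path_eq:
  assumes "u \<in> X" "v \<in> X" "u \<noteq> v"
  shows "boundary G S \<inter> path_edges (Q {u, v}) =
    {e \<in> path_edges (Q {u, v}). e \<inter> S \<noteq> {} \<and> \<not> e \<subseteq> S}"
  using path_props(3)[OF assms] unfolding boundary_def by blast

lemma even_path_boundary:
  assumes "u \<in> X" "v \<in> X" "u \<noteq> v"
  shows "even (card (boundary G S \<inter> path_edges (Q {u, v}))) \<longleftrightarrow> (u \<in> S \<longleftrightarrow> v \<in> S)"
proof -
  define p where "p = Q {u, v}"
  have "hd p = u \<and> last p = v \<or> hd p = v \<and> last p = u"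
    unfolding p_def by (fact path_props(4)[OF assms])
  then have "(hd p \<in> S \<longleftrightarrow> last p \<in> S) \<longleftrightarrow> (u \<in> S \<longleftrightarrow> v \<in> S)"
    by auto
  then show ?thesis
    using even_card_path_crossings[OF path_props(1,2)[OF assms], of S]
    unfolding boundary_path_eq[OF assms] p_def by simp
qed

text \<open>A path whose ends are separated by \<open>S\<close> crosses an odd number of times,
  hence at least once. Choosing one crossing edge for each separated pair is injective by
  edge-disjointness.\<close>

lemma cut_bound: "card (X \<inter> S) * card (X - S) \<le> card (boundary G S)"
proof -
  have "\<exists>e. e \<in> boundary G S \<inter> path_edges (Q {u, v})" if "u \<in> X \<inter> S" "v \<in> X - S" for u v
  proof -
    have "odd (card (boundary G S \<inter> path_edges (Q {u, v})))"
      using even_path_boundary[of u v S] that by auto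
    then show ?thesis
      by (metis card.empty ex_in_conv even_zero)
  qed
  then obtain g where g: "\<And>u v. u \<in> X \<inter> S \<Longrightarrow> v \<in> X - S \<Longrightarrow>
      g u v \<in> boundary G S \<inter> path_edges (Q {u, v})"
    by metis
  have "inj_on (\<lambda>(u, v). g u v) ((X \<inter> S) \<times> (X - S))"
  proof (rule inj_onI, clarify)
    fix u v u' v'
    assume h: "u \<in> X" "u \<in> S" "v \<in> X" "v \<notin> S" "u' \<in> X" "u' \<in> S" "v' \<in> X" "v' \<notin> S"
      "g u v = g u' v'"
    then have "{u, v} = {u', v'}"
      using g[of u v] g[of u' v'] by (intro path_unique[of u v u' v' "g u v"]) auto
    then show "u = u' \<and> v = v'"
      using h by (auto simp: doubleton_eq_iff)
  qed
  moreover have "(\<lambda>(u, v). g u v) ` ((X \<inter> S) \<times> (X - S)) \<subseteq> boundary G S"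
    using g by auto
  moreover have "finite (boundary G S)"
    unfolding boundary_def using finite_edges by simp
  ultimately have "card ((X \<inter> S) \<times> (X - S)) \<le> card (boundary G S)"
    by (rule card_inj_on_le)
  then show ?thesis
    by (simp add: card_cartesian_product)
qed

text \<open>The paths that end at \<open>u\<close> start with different edges there; this system of
  edges is compared with the degree of \<open>u\<close> below.\<close>

lemma end_edges:
  assumes "u \<in> X"
  obtains g where "inj_on g (X - {u})"
    "\<And>v. v \<in> X - {u} \<Longrightarrow> g v \<in> path_edges (Q {u, v}) \<and> u \<in> g v"
proof -
  have "\<exists>e\<in>path_edges (Q {u, v}). u \<in> e" if "v \<in> X - {u}" for v
    using path_edge_at_vertex[OF path_props(5,6)] assms that by blast
  then obtain g where g: "\<And>v. v \<in> X - {u} \<Longrightarrow> g v \<in> path_edges (Q {u, v}) \<and> u \<in> g v"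
    by metis
  have "inj_on g (X - {u})"
  proof (rule inj_onI)
    fix v v' assume h: "v \<in> X - {u}" "v' \<in> X - {u}" "g v = g v'"
    then have "{u, v} = {u, v'}"
      using g[of v] g[of v'] assms by (intro path_unique[of u v u v' "g v"]) auto
    then show "v = v'"
      by (auto simp: doubleton_eq_iff)
  qed
  then show thesis
    using g that by blast
qed

text \<open>The paths ending at \<open>u\<close> take \<open>card X - 1\<close> edges there, and a
  path passing through \<open>u\<close> would take two more, exceeding the degree.\<close>

lemma no_path_through_branch:
  assumes "u \<in> X" "degree G u \<le> card X" "a \<in> X" "b \<in> X" "a \<noteq> b" "u \<in> set (Q {a, b})"
  shows "u = a \<or> u = b"
proof (rule ccontr)
  assume neq: "\<not> (u = a \<or> u = b)"
  obtain g where g: "inj_on g (X - {u})"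
    "\<And>v. v \<in> X - {u} \<Longrightarrow> g v \<in> path_edges (Q {u, v}) \<and> u \<in> g v"
    using end_edges[OF assms(1)] by blast
  let ?T = "{e \<in> path_edges (Q {a, b}). u \<in> e}"
  have T: "2 \<le> card ?T"
    using path_inner_vertex_edges[of "Q {a, b}" u] path_props(1,4)[of a b] assms neq by metis
  have disj: "g ` (X - {u}) \<inter> ?T = {}"
  proof (rule ccontr)
    assume "g ` (X - {u}) \<inter> ?T \<noteq> {}"
    then obtain v where "v \<in> X - {u}" "g v \<in> path_edges (Q {a, b})"
      by auto
    then have "{u, v} = {a, b}"
      using g(2)[of v] assms by (intro path_unique[of u v a b "g v"]) auto
    then show False
      using neq by (auto simp: doubleton_eq_iff)
  qed
  have "g ` (X - {u}) \<union> ?T \<subseteq> {e \<in> edges G. u \<in> e}"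
    using g(2) path_props(3)[of u] path_props(3)[of a b] assms by blast
  then have "card (g ` (X - {u}) \<union> ?T) \<le> degree G u"
    unfolding degree_def using finite_edges by (intro card_mono) auto
  moreover have "card (g ` (X - {u}) \<union> ?T) = card (g ` (X - {u})) + card ?T"
    using disj finite_branch by (intro card_Un_disjoint) auto
  moreover have "card (g ` (X - {u})) = card X - 1" "card X > 0"
    using g(1) finite_branch assms(1) by (auto simp: card_image card_gt_0_iff)
  ultimately show False
    using T assms(2) by linarith
qed

text \<open>With degree exactly \<open>card X - 1\<close>, the injective choice of first edges at
  \<open>u\<close> is onto the edges at \<open>u\<close>.\<close>

lemma all_edges_used:
  assumes "u \<in> X" "degree G u = card X - 1" "e \<in> edges G" "u \<in> e"
  shows "\<exists>v\<in>X - {u}. e \<in> path_edges (Q {u, v})"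
proof -
  obtain g where g: "inj_on g (X - {u})"
    "\<And>v. v \<in> X - {u} \<Longrightarrow> g v \<in> path_edges (Q {u, v}) \<and> u \<in> g v"
    using end_edges[OF assms(1)] by blast
  have "g ` (X - {u}) \<subseteq> {e \<in> edges G. u \<in> e}"
    using g(2) path_props(3)[of u] assms(1) by blast
  moreover have "card (g ` (X - {u})) = card {e \<in> edges G. u \<in> e}"
    using assms(1,2) g(1) finite_branch by (simp add: card_image degree_def)
  ultimately have "g ` (X - {u}) = {e \<in> edges G. u \<in> e}"
    using finite_edges by (intro card_subset_eq) auto
  then have "e \<in> g ` (X - {u})"
    using assms(3,4) by simp
  then show ?thesis
    using g(2) by blast
qed

definition used :: "'a set set" where
  "used = (\<Union>h\<in>{{u, v} | u v. u \<in> X \<and> v \<in> X \<and> u \<noteq> v}. path_edges (Q h))"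

lemma usedI: "\<lbrakk>u \<in> X; v \<in> X; u \<noteq> v; e \<in> path_edges (Q {u, v})\<rbrakk> \<Longrightarrow> e \<in> used"
  unfolding used_def by blast

text \<open>Every path has both ends in \<open>S\<close> and so crosses an even number of times; the
  paths being edge-disjoint, these numbers add up.\<close>

lemma even_boundary_used:
  assumes "X \<subseteq> S"
  shows "even (card (boundary G S \<inter> used))"
proof -
  let ?E = "{{u, v} | u v. u \<in> X \<and> v \<in> X \<and> u \<noteq> v}"
  have "?E \<subseteq> Pow X"
    by auto
  then have fin: "finite ?E"
    using finite_branch finite_subset by blast
  have "boundary G S \<inter> used = (\<Union>h\<in>?E. boundary G S \<inter> path_edges (Q h))"
    unfolding used_def by blast
  also have "card \<dots> = (\<Sum>h\<in>?E. card (boundary G S \<inter> path_edges (Q h)))"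
  proof (rule card_UN_disjoint[OF fin])
    show "\<forall>h\<in>?E. \<forall>h'\<in>?E. h \<noteq> h' \<longrightarrow>
        (boundary G S \<inter> path_edges (Q h)) \<inter> (boundary G S \<inter> path_edges (Q h')) = {}"
      using path_unique by blast
  qed auto
  also have "even \<dots>"
    using even_path_boundary assms by (intro dvd_sum) blast
  finally show ?thesis .
qed

text \<open>
  Parity forces the one vertex of \<open>V\<close> that is not a branch vertex to lie in \<open>L\<close> and its edge
  leaving \<open>V\<close> to be unused. One of \<open>y\<close> and \<open>y'\<close> is then a branch vertex; the path using its
  edge out of \<open>V\<close> must come back at a branch vertex in \<open>L\<close>, where it ends. But that vertex is a
  neighbour of \<open>y\<close>, and the edge joining them has to be used by the same path.
\<close>

lemma no_clique_in_gadget: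
  assumes V: "finite V" "X \<subseteq> V" "card V = card X + 1"
    and L: "L \<subseteq> V" "odd (card L)" "\<And>w. w \<in> L \<Longrightarrow> f w \<notin> V"
    and bd: "boundary G V = (\<lambda>w. {w, f w}) ` L"
    and deg: "\<And>u. u \<in> V \<Longrightarrow> degree G u \<le> card X" "\<And>u. u \<in> L \<Longrightarrow> degree G u = card X - 1"
    and y: "y \<in> L" "\<And>q. q \<in> L \<Longrightarrow> q \<noteq> y \<Longrightarrow> {y, q} \<in> edges G"
    and y': "y' \<in> L" "\<And>q. q \<in> L \<Longrightarrow> q \<noteq> y' \<Longrightarrow> {y', q} \<in> edges G"
    and "y \<noteq> y'"
  shows False
proof -
  have inj: "inj_on (\<lambda>w. {w, f w}) L"
  proof (rule inj_onI)
    fix w w' assume "w \<in> L" "w' \<in> L" "{w, f w} = {w', f w'}"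
    then show "w = w'"
      using L(1,3) by (auto simp: doubleton_eq_iff)
  qed
  have outer: "\<exists>v\<in>X - {u}. {u, f u} \<in> path_edges (Q {u, v})" if "u \<in> L" "u \<in> X" for u
  proof -
    have "{u, f u} \<in> edges G"
      using that bd unfolding boundary_def by blast
    then show ?thesis
      using that deg(2) by (intro all_edges_used) auto
  qed
  have outer_used: "{u, f u} \<in> used" if "u \<in> L" "u \<in> X" for u
    using outer[OF that] that usedI by auto
  \<comment> \<open>If every edge of the cut were used, the even number of used cut edges would be
    the odd number \<open>card L\<close>.\<close>
  obtain w where w: "w \<in> L" "{w, f w} \<notin> used"
  proof -
    have "\<not> boundary G V \<subseteq> used"
    proof
      assume "boundary G V \<subseteq> used"
      then have "boundary G V \<inter> used = (\<lambda>w. {w, f w}) ` L"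
        using bd by auto
      then show False
        using even_boundary_used[OF V(2)] L(2) inj by (simp add: card_image)
    qed
    then show thesis
      using that bd by auto
  qed
  then have "w \<in> V - X"
    using outer_used L(1) by auto
  moreover have "card (V - X) = 1"
    using V finite_branch by (simp add: card_Diff_subset)
  ultimately have VX: "V - X = {w}"
    by (metis card_1_singletonE singletonD)
  \<comment> \<open>The vertex \<open>m\<close> is one of \<open>y\<close>, \<open>y'\<close> that
    differs from \<open>w\<close>.\<close>
  obtain m where m: "m \<in> L" "m \<in> X" and m_adj: "\<And>q. q \<in> L \<Longrightarrow> q \<noteq> m \<Longrightarrow> {m, q} \<in> edges G"
  proof (cases "y = w")
    case True
    then have "y' \<in> X"
      using VX L(1) y'(1) \<open>y \<noteq> y'\<close> by auto
    then show thesis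
      using that y' by metis
  next
    case False
    then have "y \<in> X"
      using VX L(1) y(1) by auto
    then show thesis
      using that y by metis
  qed
  obtain v where v: "v \<in> X" "v \<noteq> m" "{m, f m} \<in> path_edges (Q {m, v})"
    using outer[OF m] by auto
  let ?C = "boundary G V \<inter> path_edges (Q {m, v})"
  have "even (card ?C)"
    using even_path_boundary[of m v V] v m V(2) by auto
  moreover have "{m, f m} \<in> ?C"
    using v(3) bd m(1) by auto
  \<comment> \<open>Both \<open>m\<close> and \<open>v\<close> lie in \<open>V\<close>, so the path
    that leaves through the edge of \<open>m\<close> crosses the cut a second time, through the edge
    of some \<open>q\<close>.\<close>
  ultimately have "?C \<noteq> {{m, f m}}"
    by auto
  then obtain q where q: "q \<in> L" "{q, f q} \<in> path_edges (Q {m, v})" "{q, f q} \<noteq> {m, f m}"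
    using \<open>{m, f m} \<in> ?C\<close> bd by auto
  have "q \<noteq> w"
    using q(2) w(2) usedI[of m v] m v by auto
  then have "q \<in> X"
    using q(1) VX L(1) by auto
  moreover have "q \<in> set (Q {m, v})"
    using path_edges_subset[OF q(2)] by auto
  \<comment> \<open>The path cannot pass through the branch vertex \<open>q\<close>, and
    \<open>q\<close> is not \<open>m\<close> because their cut edges differ.\<close>
  ultimately have "q = v"
    using no_path_through_branch[of q m v] deg(1) m v q V(2) by auto
  then have "{m, v} \<in> edges G"
    using m_adj q(1) v(2) by auto
  then obtain v' where v': "v' \<in> X" "v' \<noteq> m" "{m, v} \<in> path_edges (Q {m, v'})"
    using all_edges_used[of m "{m, v}"] m deg(2) by auto
  have "v \<in> set (Q {m, v'})"
    using path_edges_subset[OF v'(3)] by auto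
  \<comment> \<open>Again the path containing the edge \<open>{m, v}\<close> may meet the branch
    vertex \<open>v\<close> only at an end, so it is the path from \<open>m\<close> to
    \<open>v\<close>.\<close>
  then have "v = v'"
    using no_path_through_branch[of v m v'] deg(1) m v v' V(2) by auto
  then have "{m, v} \<in> path_edges (Q {m, v})"
    using v'(3) by simp
  moreover have "m = hd (Q {m, v}) \<or> m = last (Q {m, v})"
    using path_props(4)[OF m(2) v(1) v(2)[symmetric]] by metis
  \<comment> \<open>That path now has both \<open>{m, v}\<close> and \<open>{m, f m}\<close> at its
    end \<open>m\<close>, so they coincide and put \<open>f m\<close> inside
    \<open>V\<close>.\<close>
  ultimately have "{m, v} = {m, f m}"
    using path_edge_at_end_unique[OF path_props(1)[OF m(2) v(1) v(2)[symmetric]]] v(3) by blast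
  then have "f m = v"
    using v(2) by (auto simp: doubleton_eq_iff)
  then show False
    using L(3) m(1) v(1) V(2) by auto
qed

end

lemma immersed_complete_graphE:
  assumes "immersed (complete_graph I) G" "finite I" "finite (edges G)"
  obtains X Q where "clique_immersion G X Q" "X \<subseteq> verts G" "card X = card I"
proof -
  obtain \<phi> p where inj: "inj_on \<phi> I" and sub: "\<phi> ` I \<subseteq> verts G"
    and path: "\<forall>u v. {u, v} \<in> edges (complete_graph I) \<longrightarrow> path_between G (\<phi> u) (\<phi> v) (p {u, v})"
    and disj: "\<forall>e\<in>edges (complete_graph I). \<forall>h\<in>edges (complete_graph I). e \<noteq> h \<longrightarrow>
      path_edges (p e) \<inter> path_edges (p h) = {}"
    using assms(1) unfolding immersed_def verts_complete_graph
    by (elim exE conjE) (rule that)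
  \<comment> \<open>Pulling a pair of branch vertices back along the injective \<open>\<phi>\<close>
    recovers the edge of the complete graph to which \<open>p\<close> assigns a path.\<close>
  define Q where "Q e = p (inv_into I \<phi> ` e)" for e
  have Q: "Q {\<phi> u, \<phi> v} = p {u, v}" if "u \<in> I" "v \<in> I" for u v
    using that inj by (simp add: Q_def)
  have edge: "{u, v} \<in> edges (complete_graph I)" if "u \<in> I" "v \<in> I" "u \<noteq> v" for u v
    using that by (auto simp: complete_graph_def)
  have "clique_immersion G (\<phi> ` I) Q"
  proof
    show "finite (edges G)" "finite (\<phi> ` I)"
      using assms by auto
    show "path_between G u v (Q {u, v})" if uv: "u \<in> \<phi> ` I" "v \<in> \<phi> ` I" "u \<noteq> v" for u v
    proof -
      obtain x y where xy: "x \<in> I" "y \<in> I" "u = \<phi> x" "v = \<phi> y"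
        using uv by blast
      then show ?thesis
        using Q[OF xy(1,2)] path[rule_format, OF edge[OF xy(1,2)]] uv(3) by auto
    qed
    show "{u, v} = {u', v'}" if uv: "u \<in> \<phi> ` I" "v \<in> \<phi> ` I" "u \<noteq> v" "u' \<in> \<phi> ` I" "v' \<in> \<phi> ` I" "u' \<noteq> v'"
      "e \<in> path_edges (Q {u, v})" "e \<in> path_edges (Q {u', v'})" for u v u' v' e
    proof -
      obtain x y x' y' where xy: "x \<in> I" "y \<in> I" "x' \<in> I" "y' \<in> I" "u = \<phi> x" "v = \<phi> y"
        "u' = \<phi> x'" "v' = \<phi> y'"
        using uv by blast
      then have "x \<noteq> y" "x' \<noteq> y'"
        using uv by auto
      then have "path_edges (p {x, y}) \<inter> path_edges (p {x', y'}) = {}" if "{x, y} \<noteq> {x', y'}"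
        using disj edge xy(1-4) that by simp
      then have "{x, y} = {x', y'}"
        using uv(7,8) Q xy by auto
      then have "\<phi> ` {x, y} = \<phi> ` {x', y'}"
        by simp
      then show ?thesis
        using xy by simp
    qed
  qed
  then show thesis
    using that[of "\<phi> ` I" Q] sub inj by (simp add: card_image)
qed

section \<open>The copies of \<open>P\<^sup>5\<^sub>d\<close>\<close>

lemma card_complete_graph_edges_at:
  assumes "finite V" "w \<in> V"
  shows "card {e \<in> edges (complete_graph V). w \<in> e} = card V - 1"
proof -
  have "{e \<in> edges (complete_graph V). w \<in> e} = (\<lambda>b. {w, b}) ` (V - {w})"
    using assms(2) by (auto simp: complete_graph_def)
  moreover have "inj_on (\<lambda>b. {w, b}) (V - {w})"
    by (auto simp: inj_on_def doubleton_eq_iff)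
  ultimately show ?thesis
    using assms by (simp add: card_image)
qed

lemma degree_delete_edges_complete:
  assumes "finite V" "w \<in> V" "D \<subseteq> edges (complete_graph V)"
  shows "degree (delete_edges (complete_graph V) D) w = card V - 1 - card {e \<in> D. w \<in> e}"
proof -
  have "finite D"
    using assms(1,3) complete_graph_edgeD by (intro finite_subset[of D "Pow V"]) auto
  moreover have "{e \<in> edges (delete_edges (complete_graph V) D). w \<in> e} =
    {e \<in> edges (complete_graph V). w \<in> e} - {e \<in> D. w \<in> e}"
    by (auto simp: delete_edges_def)
  moreover have "{e \<in> D. w \<in> e} \<subseteq> {e \<in> edges (complete_graph V). w \<in> e}"
    using assms(3) by auto
  ultimately show ?thesis
    using card_complete_graph_edges_at[OF assms(1,2)]
    by (simp add: degree_def card_Diff_subset)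
qed

text \<open>Evaluates the edges at a vertex of an explicitly listed edge set, one listed edge at a
  time.\<close>

lemma edges_at_insert:
  "{e \<in> insert h A. w \<in> e} = (if w \<in> h then insert h {e \<in> A. w \<in> e} else {e \<in> A. w \<in> e})"
  by auto

text \<open>Everything follows from counting deleted edges: two at each of \<open>y\<close>,
  \<open>y'\<close>, \<open>t\<close>, \<open>u\<close>, \<open>v\<close>, one at the path ends, at
  most one elsewhere. The two vertices in the last claim are the path middles: their deleted edges
  go to path ends, so they keep their edges to all other low vertices.\<close>

lemma P5_structure:
  assumes "is_P5 d P" "8 \<le> d"
  shows "finite (verts P)" "card (verts P) = d + 1" "edges P \<subseteq> edges (complete_graph (verts P))"
    "card (low_verts d P) = 5"
    "\<And>w. w \<in> verts P \<Longrightarrow> degree P w \<le> d"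
    "\<And>w. w \<in> verts P \<Longrightarrow> w \<notin> low_verts d P \<Longrightarrow> d - 1 \<le> degree P w"
    "\<exists>y y'. y \<noteq> y' \<and> y \<in> low_verts d P \<and> y' \<in> low_verts d P \<and>
      (\<forall>q\<in>low_verts d P. (q \<noteq> y \<longrightarrow> {y, q} \<in> edges P) \<and> (q \<noteq> y' \<longrightarrow> {y', q} \<in> edges P))"
proof -
  obtain x y z x' y' z' t u v M where
    fin: "finite (verts P)" and card: "card (verts P) = d + 1" and
    dist: "distinct [x, y, z, x', y', z', t, u, v]" and
    sub: "set [x, y, z, x', y', z', t, u, v] \<subseteq> verts P" and
    M: "maximum_matching (complete_graph (verts P - set [x, y, z, x', y', z', t, u, v])) M" and
    P: "P = delete_edges (complete_graph (verts P))
      (path_edges [x, y, z] \<union> path_edges [x', y', z'] \<union> path_edges [t, u, v, t] \<union> M)"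
    using assms(1) unfolding is_P5_def by auto
  \<comment> \<open>The reversed list supplies each inequality in the other orientation for the
    simplifier.\<close>
  have "distinct [v, u, t, z', y', x', z, y, x]"
    using dist by auto
  note neq = dist[simplified] this[simplified]
  let ?V = "verts P"
  let ?N = "{x, y, z, x', y', z', t, u, v}"
  define B where "B = {{x, y}, {y, z}, {x', y'}, {y', z'}, {t, u}, {u, v}, {v, t}}"
  have P: "P = delete_edges (complete_graph ?V) (B \<union> M)"
    using P by (simp add: B_def Un_assoc insert_commute)
  have M_sub: "M \<subseteq> edges (complete_graph (?V - ?N))" and M_disj: "pairwise disjnt M"
    using M unfolding maximum_matching_def matching_def by auto
  have MN: "e \<inter> ?N = {}" if "e \<in> M" for e
    using that M_sub complete_graph_edgeD[of e "?V - ?N"] by auto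
  have "M \<subseteq> edges (complete_graph ?V)"
    using M_sub unfolding subset_iff edges_complete_graph_iff by blast
  moreover have "B \<subseteq> edges (complete_graph ?V)"
    using sub neq unfolding B_def insert_subset edges_complete_graph_iff by simp blast
  ultimately have deg: "degree P w = d - card {e \<in> B \<union> M. w \<in> e}" if "w \<in> ?V" for w
    using degree_delete_edges_complete[OF fin that, of "B \<union> M"] card P by auto
  have B_eq: "{e \<in> B \<union> M. w \<in> e} = {e \<in> B. w \<in> e}" if "w \<in> ?N" for w
    using MN that by blast
  have two: "degree P w = d - 2" if "w \<in> {y, y', t, u, v}" for w
  proof -
    have "card {e \<in> B. w \<in> e} = 2"
      using that unfolding B_def edges_at_insert
      by (elim insertE) (simp_all add: neq doubleton_eq_iff)
    moreover have "w \<in> ?N" "w \<in> ?V"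
      using that sub by auto
    ultimately show ?thesis
      using deg[of w] B_eq[of w] by simp
  qed
  have one: "d - 1 \<le> degree P w" if "w \<in> ?V" "w \<notin> {y, y', t, u, v}" for w
  proof -
    have "card {e \<in> B \<union> M. w \<in> e} \<le> 1"
    proof (cases "w \<in> ?N")
      case True
      then have "w \<in> {x, z, x', z'}"
        using that(2) by auto
      then have "card {e \<in> B. w \<in> e} = 1"
        unfolding B_def edges_at_insert by (elim insertE) (simp_all add: neq)
      then show ?thesis
        unfolding B_eq[OF True] by simp
    next
      case False
      then have "{e \<in> B \<union> M. w \<in> e} = {e \<in> M. w \<in> e}"
        unfolding B_def by auto
      moreover have "e = e'" if "e \<in> M" "e' \<in> M" "w \<in> e" "w \<in> e'" for e e'
        using M_disj that by (auto simp: pairwise_def disjnt_iff)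
      \<comment> \<open>An infinite set has cardinality 0, so the bound also holds in that case of
        the split.\<close>
      ultimately show ?thesis
        using card_le_Suc0_iff_eq[of "{e \<in> M. w \<in> e}"]
        by (cases "finite {e \<in> M. w \<in> e}") auto
    qed
    then show ?thesis
      using deg[OF that(1)] by simp
  qed
  show "finite ?V" "card ?V = d + 1"
    by (fact fin card)+
  have "edges P = edges (complete_graph ?V) - (B \<union> M)"
    by (subst P) (simp add: delete_edges_def)
  then show "edges P \<subseteq> edges (complete_graph ?V)"
    by blast
  have low: "low_verts d P = {y, y', t, u, v}"
  proof
    have "degree P w \<noteq> d - 2" if "w \<in> ?V" "w \<notin> {y, y', t, u, v}" for w
      using one[OF that] assms(2) by simp
    then show "low_verts d P \<subseteq> {y, y', t, u, v}"
      unfolding low_verts_def by blast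
    have "{y, y', t, u, v} \<subseteq> ?V"
      using sub by simp
    then show "{y, y', t, u, v} \<subseteq> low_verts d P"
      using two unfolding low_verts_def by blast
  qed
  show "card (low_verts d P) = 5"
    unfolding low by (simp add: neq)
  show "degree P w \<le> d" if "w \<in> ?V" for w
    using deg[OF that] by simp
  show "d - 1 \<le> degree P w" if "w \<in> ?V" "w \<notin> low_verts d P" for w
    using one that low by auto
  have adj: "{p, q} \<in> edges P" if "p \<in> {y, y'}" "q \<in> {y, y', t, u, v}" "q \<noteq> p" for p q
  proof -
    have "{p, q} \<notin> M"
      using MN[of "{p, q}"] that(1) by auto
    moreover have "{p, q} \<notin> B"
      using that unfolding B_def by (elim insertE) (simp_all add: neq doubleton_eq_iff)
    moreover have "{p, q} \<in> edges (complete_graph ?V)"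
      using that sub by (auto simp: complete_graph_def)
    ultimately show ?thesis
      using \<open>edges P = edges (complete_graph ?V) - (B \<union> M)\<close> by auto
  qed
  show "\<exists>y y'. y \<noteq> y' \<and> y \<in> low_verts d P \<and> y' \<in> low_verts d P \<and>
      (\<forall>q\<in>low_verts d P. (q \<noteq> y \<longrightarrow> {y, q} \<in> edges P) \<and> (q \<noteq> y' \<longrightarrow> {y', q} \<in> edges P))"
    unfolding low using adj neq by (intro exI[of _ y] exI[of _ y'] conjI ballI impI) simp_all
qed

section \<open>The graphs \<open>H\<^sup>5\<^sub>d\<close>\<close>

locale H5_graph =
  fixes d n :: nat and a :: "nat \<Rightarrow> nat \<Rightarrow> 'a" and \<C> :: "'a graph set" and f :: "'a \<Rightarrow> 'a"
    and H :: "'a graph"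
  assumes d_ge: "8 \<le> d" and n_ge: "1 \<le> n"
    and inj: "inj_on (\<lambda>(i, j). a i j) ({..<n} \<times> {1..d - 2})"
    and finite_copies: "finite \<C>"
    and copy: "P \<in> \<C> \<Longrightarrow> is_P5 d P"
    and copies_disjoint: "\<lbrakk>P \<in> \<C>; P' \<in> \<C>; P \<noteq> P'\<rbrakk> \<Longrightarrow> verts P \<inter> verts P' = {}"
    and copy_bay_disjoint: "\<lbrakk>P \<in> \<C>; i < n\<rbrakk> \<Longrightarrow> verts P \<inter> bay d a i = {}"
    and attached: "P \<in> \<C> \<Longrightarrow> \<exists>i<n. \<forall>w\<in>low_verts d P. f w \<in> bay d a i"
    and verts_H: "verts H = (\<Union>i<n. bay d a i) \<union> (\<Union>P\<in>\<C>. verts P)"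
    and edges_H: "edges H = (\<Union>i<n. edges (complete_graph (bay d a i))) \<union> bay_links d n a \<union>
      (\<Union>P\<in>\<C>. edges P \<union> {{w, f w} | w. w \<in> low_verts d P})"
    and bay_degree: "\<lbrakk>i < n; x \<in> bay d a i\<rbrakk> \<Longrightarrow> d - 1 \<le> degree H x"
begin

lemmas copy_structure = P5_structure[OF copy d_ge]

lemma low_subset: "low_verts d P \<subseteq> verts P"
  by (auto simp: low_verts_def)

lemma copy_edgeD: "P \<in> \<C> \<Longrightarrow> e \<in> edges P \<Longrightarrow> e \<subseteq> verts P"
  using copy_structure(3) complete_graph_edgeD by blast

text \<open>The joining rule between bay \<open>i\<close> and its predecessor, without the exclusion
  of loops made in \<open>bay_links\<close>.\<close>

definition link :: "nat \<Rightarrow> nat \<Rightarrow> 'a set" where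
  "link i j = {a i j, a ((i + n - 1) mod n) (d - 1 - j)}"

text \<open>The ceiling bound says \<open>j - 1 < (d - 2) / 2\<close>, that is
  \<open>2 * j < d\<close>; this leaves \<open>(d - 1) div 2\<close> values of \<open>j\<close> for
  each bay \<open>i\<close>.\<close>

lemma bay_linkE:
  assumes "e \<in> bay_links d n a"
  obtains i j where "i < n" "1 \<le> j" "2 * j < d" "e = link i j"
proof -
  obtain i j where ij: "i < n" "1 \<le> j" "int j \<le> \<lceil>(real d - 2) / 2\<rceil>" "e = link i j"
    using assms unfolding bay_links_def link_def by blast
  then have "real_of_int (int j) - 1 < (real d - 2) / 2"
    by (simp only: le_ceiling_iff)
  then have "2 * j < d"
    by simp
  then show thesis
    using ij that by blast
qed

lemma a_in_bay: "1 \<le> j \<Longrightarrow> j \<le> d - 2 \<Longrightarrow> a i j \<in> bay d a i"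
  by (auto simp: bay_def)

lemma card_bay_le: "card (bay d a i) \<le> d - 2"
  unfolding bay_def using card_image_le[of "{1..d - 2}" "a i"] by simp

lemma bay_disjoint:
  assumes "i < n" "i' < n" "x \<in> bay d a i" "x \<in> bay d a i'"
  shows "i = i'"
proof -
  obtain j j' where "j \<in> {1..d - 2}" "j' \<in> {1..d - 2}" "a i j = a i' j'"
    using assms(3,4) unfolding bay_def by auto
  then show ?thesis
    using inj_onD[OF inj, of "(i, j)" "(i', j')"] assms(1,2) by auto
qed

lemma prev_less: "(i + n - 1) mod n < n"
  using n_ge by simp

lemma link_ends_in_bays:
  assumes "1 \<le> j" "2 * j < d"
  shows "a i j \<in> bay d a i" "a i' (d - 1 - j) \<in> bay d a i'"
  using assms d_ge by (auto intro!: a_in_bay)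

lemma attach_vertex: "P \<in> \<C> \<Longrightarrow> w \<in> low_verts d P \<Longrightarrow> \<exists>i<n. f w \<in> bay d a i"
  using attached by blast

lemma attach_not_in_copy: "P \<in> \<C> \<Longrightarrow> w \<in> low_verts d P \<Longrightarrow> P' \<in> \<C> \<Longrightarrow> f w \<notin> verts P'"
  using attach_vertex copy_bay_disjoint by blast

lemma bay_not_in_copy: "i < n \<Longrightarrow> x \<in> bay d a i \<Longrightarrow> P \<in> \<C> \<Longrightarrow> x \<notin> verts P"
  using copy_bay_disjoint by blast

lemma edge_cases [consumes 1, case_names bay link copy attach]:
  assumes "e \<in> edges H"
  obtains i where "i < n" "e \<subseteq> bay d a i" "e \<in> edges (complete_graph (bay d a i))"
  | i j where "i < n" "1 \<le> j" "2 * j < d" "e = link i j" "a i j \<in> bay d a i"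
      "a ((i + n - 1) mod n) (d - 1 - j) \<in> bay d a ((i + n - 1) mod n)"
  | P where "P \<in> \<C>" "e \<in> edges P" "e \<subseteq> verts P"
  | P w where "P \<in> \<C>" "w \<in> low_verts d P" "w \<in> verts P" "e = {w, f w}"
proof -
  consider i where "i < n" "e \<in> edges (complete_graph (bay d a i))" | "e \<in> bay_links d n a"
    | P where "P \<in> \<C>" "e \<in> edges P" | P w where "P \<in> \<C>" "w \<in> low_verts d P" "e = {w, f w}"
    using assms unfolding edges_H by blast
  then show thesis
  proof cases
    case (1 i)
    then show ?thesis
      using that(1) complete_graph_edgeD by blast
  next
    case 2
    then obtain i j where "i < n" "1 \<le> j" "2 * j < d" "e = link i j"
      using bay_linkE by blast
    then show ?thesis
      using that(2) link_ends_in_bays by blast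
  next
    case (3 P)
    then show ?thesis
      using that(3) copy_edgeD by blast
  next
    case (4 P w)
    then show ?thesis
      using that(4)[OF 4(1,2) subsetD[OF low_subset 4(2)] 4(3)] by simp
  qed
qed

text \<open>A vertex of a copy lies in no bay and in no other copy, and every \<open>f w\<close> is
  a bay vertex, so only its own attaching edge can leave the copy.\<close>

lemma edges_at_copy:
  assumes "P \<in> \<C>" "w \<in> verts P"
  shows "{e \<in> edges H. w \<in> e} =
    {e \<in> edges P. w \<in> e} \<union> (if w \<in> low_verts d P then {{w, f w}} else {})"
proof
  show "{e \<in> edges H. w \<in> e} \<subseteq>
    {e \<in> edges P. w \<in> e} \<union> (if w \<in> low_verts d P then {{w, f w}} else {})"
  proof
    fix e assume "e \<in> {e \<in> edges H. w \<in> e}"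
    then have "e \<in> edges H" "w \<in> e"
      by auto
    then show "e \<in> {e \<in> edges P. w \<in> e} \<union> (if w \<in> low_verts d P then {{w, f w}} else {})"
    proof (cases rule: edge_cases)
      case (bay i)
      then show ?thesis
        using bay_not_in_copy assms \<open>w \<in> e\<close> by blast
    next
      case (link i j)
      then show ?thesis
        using bay_not_in_copy[OF _ _ assms(1)] prev_less assms(2) \<open>w \<in> e\<close> unfolding link_def
        by blast
    next
      case (copy P')
      then have "P' = P"
        using copies_disjoint assms \<open>w \<in> e\<close> by blast
      then show ?thesis
        using copy \<open>w \<in> e\<close> by simp
    next
      case (attach P' w')
      then have "w = w'"
        using attach_not_in_copy assms \<open>w \<in> e\<close> by blast
      moreover from this have "P' = P"
        using copies_disjoint attach assms by blast
      ultimately show ?thesis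
        using attach by simp
    qed
  qed
  show "{e \<in> edges P. w \<in> e} \<union> (if w \<in> low_verts d P then {{w, f w}} else {}) \<subseteq>
    {e \<in> edges H. w \<in> e}"
    using assms(1) unfolding edges_H by auto
qed

section \<open>Finiteness, degrees and the cut around a copy\<close>

lemma finite_verts: "finite (verts H)"
  unfolding verts_H using finite_copies copy_structure(1) by (auto simp: bay_def)

lemma edge_subset_verts:
  assumes "e \<in> edges H"
  shows "e \<subseteq> verts H"
  using assms
proof (cases rule: edge_cases)
  case (link i j)
  then show ?thesis
    using prev_less[of i] unfolding link_def verts_H by blast
next
  case (attach P w)
  then show ?thesis
    using attach_vertex[of P w] unfolding verts_H by blast
qed (auto simp: verts_H)

lemma finite_edges: "finite (edges H)"
  using finite_verts edge_subset_verts by (intro finite_subset[of "edges H" "Pow (verts H)"]) auto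

lemma degree_copy:
  assumes "P \<in> \<C>" "w \<in> verts P"
  shows "degree H w = degree P w + (if w \<in> low_verts d P then 1 else 0)"
proof -
  have "{w, f w} \<notin> edges P" if "w \<in> low_verts d P"
    using copy_edgeD[of P "{w, f w}"] attach_not_in_copy that assms(1) by auto
  moreover have "finite {e \<in> edges P. w \<in> e}"
    using edges_at_copy[OF assms] finite_edges by (auto intro: finite_subset[of _ "edges H"])
  ultimately show ?thesis
    unfolding degree_def edges_at_copy[OF assms] by simp
qed

lemma degree_low: "P \<in> \<C> \<Longrightarrow> w \<in> low_verts d P \<Longrightarrow> degree H w = d - 1"
  using degree_copy[of P w] low_subset[of P] d_ge by (auto simp: low_verts_def)

lemma degree_copy_bounds:
  assumes "P \<in> \<C>" "w \<in> verts P"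
  shows "d - 1 \<le> degree H w" "degree H w \<le> d"
proof -
  show "d - 1 \<le> degree H w"
    using degree_copy[OF assms] degree_low[OF assms(1), of w]
      copy_structure(6)[OF assms(1,2)] by (cases "w \<in> low_verts d P") auto
  show "degree H w \<le> d"
    using degree_copy[OF assms] degree_low[OF assms(1), of w]
      copy_structure(5)[OF assms(1,2)] by (cases "w \<in> low_verts d P") auto
qed

lemma boundary_copy:
  assumes "P \<in> \<C>"
  shows "boundary H (verts P) = (\<lambda>w. {w, f w}) ` low_verts d P"
proof
  show "boundary H (verts P) \<subseteq> (\<lambda>w. {w, f w}) ` low_verts d P"
  proof
    fix e assume "e \<in> boundary H (verts P)"
    then obtain w where w: "e \<in> edges H" "w \<in> e" "w \<in> verts P" "\<not> e \<subseteq> verts P"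
      unfolding boundary_def by blast
    then have "e \<in> {e \<in> edges P. w \<in> e} \<union> (if w \<in> low_verts d P then {{w, f w}} else {})"
      using edges_at_copy[OF assms w(3)] by blast
    moreover have "e \<notin> edges P"
      using copy_edgeD assms w(4) by blast
    ultimately show "e \<in> (\<lambda>w. {w, f w}) ` low_verts d P"
      by (auto split: if_splits)
  qed
  show "(\<lambda>w. {w, f w}) ` low_verts d P \<subseteq> boundary H (verts P)"
    using assms low_subset[of P] attach_not_in_copy[OF assms _ assms]
    unfolding boundary_def edges_H by blast
qed

text \<open>The minimum degree is attained in a copy, so one must exist. Without copies, the vertex
  \<open>a 0 1\<close> would have at most \<open>d - 3\<close> neighbours in its bay and one link,
  short of the required degree \<open>d - 1\<close>.\<close>

lemma copies_nonempty: "\<C> \<noteq> {}"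
proof
  assume empty: "\<C> = {}"
  let ?v = "a 0 1"
  let ?l = "link 0 1"
  have v: "?v \<in> bay d a 0"
    using d_ge by (intro a_in_bay) auto
  have "{e \<in> edges H. ?v \<in> e} \<subseteq> insert ?l {e \<in> edges (complete_graph (bay d a 0)). ?v \<in> e}"
  proof
    fix e assume "e \<in> {e \<in> edges H. ?v \<in> e}"
    then have e: "e \<in> edges H" "?v \<in> e"
      by auto
    from e(1) show "e \<in> insert ?l {e \<in> edges (complete_graph (bay d a 0)). ?v \<in> e}"
    proof (cases rule: edge_cases)
      case (bay i)
      then have "i = 0"
        using bay_disjoint[of i 0 ?v] v e(2) n_ge by auto
      then show ?thesis
        using bay e by simp
    next
      case (link i j)
      have "?v = a i j \<or> ?v = a ((i + n - 1) mod n) (d - 1 - j)"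
        using link e(2) unfolding link_def by blast
      then show ?thesis
      proof
        assume "?v = a i j"
        then have "(0, 1) = (i, j)"
          using inj link n_ge d_ge by (elim inj_onD) auto
        then show ?thesis
          using link by simp
      next
        \<comment> \<open>Being the second end of a link would force \<open>j = d - 2\<close>, which
          violates \<open>2 * j < d\<close>.\<close>
        assume "?v = a ((i + n - 1) mod n) (d - 1 - j)"
        then have "(0, 1) = ((i + n - 1) mod n, d - 1 - j)"
          using inj link prev_less[of i] n_ge d_ge by (elim inj_onD) auto
        then show ?thesis
          using link d_ge by auto
      qed
    qed (use empty in auto)
  qed
  then have "degree H ?v \<le> card (insert ?l {e \<in> edges (complete_graph (bay d a 0)). ?v \<in> e})"
    unfolding degree_def
    by (intro card_mono) (auto simp: bay_def finite_complete_graph_edges)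
  also have "\<dots> \<le> Suc (card {e \<in> edges (complete_graph (bay d a 0)). ?v \<in> e})"
    by (rule card_insert_le_m1) auto
  also have "\<dots> = Suc (card (bay d a 0) - 1)"
    using card_complete_graph_edges_at[of "bay d a 0" ?v] v by (simp add: bay_def)
  also have "\<dots> \<le> Suc (d - 3)"
    using card_bay_le[of 0] by simp
  finally show False
    using bay_degree[OF _ v] n_ge d_ge by simp
qed

lemma min_degree_eq: "min_degree H = d - 1"
proof -
  have lower: "d - 1 \<le> degree H v" if "v \<in> verts H" for v
    using that bay_degree degree_copy_bounds(1) unfolding verts_H by blast
  obtain P where P: "P \<in> \<C>"
    using copies_nonempty by blast
  then have "low_verts d P \<noteq> {}"
    using copy_structure(4)[OF P] by auto
  then obtain w where w: "w \<in> low_verts d P"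
    by blast
  then have "w \<in> verts H"
    using P subsetD[OF low_subset w] unfolding verts_H by blast
  then have "d - 1 \<in> degree H ` verts H"
    using degree_low[OF P w] by (metis imageI)
  then show ?thesis
    unfolding min_degree_def using finite_verts lower by (intro Min_eqI) auto
qed

section \<open>Arcs of bays and their edge cuts\<close>

definition home :: "'a graph \<Rightarrow> nat" where
  "home P = (SOME i. i < n \<and> (\<forall>w\<in>low_verts d P. f w \<in> bay d a i))"

lemma home:
  assumes "P \<in> \<C>"
  shows "home P < n" "w \<in> low_verts d P \<Longrightarrow> f w \<in> bay d a (home P)"
  using someI_ex[OF attached[OF assms]] unfolding home_def by blast+

text \<open>Each copy travels with the bay it is attached to, so that attaching edges never cross
  the cut.\<close>

definition region :: "nat set \<Rightarrow> 'a set" where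
  "region I = (\<Union>i\<in>I. bay d a i) \<union> (\<Union>P\<in>{P \<in> \<C>. home P \<in> I}. verts P)"

lemma bay_in_region_iff:
  assumes "I \<subseteq> {..<n}" "i < n" "x \<in> bay d a i"
  shows "x \<in> region I \<longleftrightarrow> i \<in> I"
  using assms bay_disjoint bay_not_in_copy unfolding region_def by blast

lemma copy_in_region_iff:
  assumes "I \<subseteq> {..<n}" "P \<in> \<C>" "x \<in> verts P"
  shows "x \<in> region I \<longleftrightarrow> home P \<in> I"
  using assms copies_disjoint bay_not_in_copy unfolding region_def by blast

lemma boundary_region:
  assumes I: "I \<subseteq> {..<n}" and "e \<in> boundary H (region I)"
  obtains i j where "i < n" "1 \<le> j" "2 * j < d" "e = link i j" "i \<in> I \<longleftrightarrow> (i + n - 1) mod n \<notin> I"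
proof -
  have e: "e \<in> edges H" "e \<inter> region I \<noteq> {}" "\<not> e \<subseteq> region I"
    using assms(2) unfolding boundary_def by auto
  from e(1) show thesis
  proof (cases rule: edge_cases)
    case (bay i)
    then show ?thesis
      using bay_in_region_iff[OF I] e(2,3) by blast
  next
    case (link i j)
    then have "a i j \<in> region I \<longleftrightarrow> i \<in> I"
      "a ((i + n - 1) mod n) (d - 1 - j) \<in> region I \<longleftrightarrow> (i + n - 1) mod n \<in> I"
      using bay_in_region_iff[OF I] prev_less by auto
    then show ?thesis
      using e(2,3) link that[of i j] unfolding link_def by blast
  next
    case (copy P)
    then show ?thesis
      using copy_in_region_iff[OF I] e(2,3) by blast
  next
    case (attach P w)
    then have "w \<in> region I \<longleftrightarrow> f w \<in> region I"
      using copy_in_region_iff[OF I] bay_in_region_iff[OF I] home by blast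
    then show ?thesis
      using e(2,3) attach by blast
  qed
qed

text \<open>An arc has two junctions with the rest of the cycle: the links with index
  \<open>l\<close> going back from its first bay, and those with index \<open>m mod n\<close> going
  back to its last bay. Each junction has at most \<open>(d - 1) div 2\<close> links.\<close>

lemma card_boundary_arc:
  assumes "l < m" "m \<le> n"
  shows "card (boundary H (region {l..<m})) \<le> d - 1"
proof -
  have "boundary H (region {l..<m}) \<subseteq> (\<lambda>(i, j). link i j) ` ({l, m mod n} \<times> {1..(d - 1) div 2})"
  proof
    fix e assume "e \<in> boundary H (region {l..<m})"
    moreover have "{l..<m} \<subseteq> {..<n}"
      using assms by auto
    ultimately obtain i j where ij: "i < n" "1 \<le> j" "2 * j < d" "e = link i j"
      and cross: "i \<in> {l..<m} \<longleftrightarrow> (i + n - 1) mod n \<notin> {l..<m}"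
      using boundary_region by blast
    have "i = l \<or> i = m mod n"
    proof (cases i)
      \<comment> \<open>The predecessor is bay \<open>n - 1\<close>: either bay 0 is in the arc and
        \<open>l = 0\<close>, or bay \<open>n - 1\<close> is and \<open>m = n\<close>.\<close>
      case 0
      then show ?thesis
        using cross assms n_ge by (cases "m = n") auto
    next
      case (Suc k)
      then have "(i + n - 1) mod n = k"
        using ij(1) by simp
      then show ?thesis
        using cross assms Suc ij(1) by (cases "m = n") auto
    qed
    moreover have "j \<in> {1..(d - 1) div 2}"
      using ij by auto
    ultimately show "e \<in> (\<lambda>(i, j). link i j) ` ({l, m mod n} \<times> {1..(d - 1) div 2})"
      using ij(4) by blast
  qed
  then have "card (boundary H (region {l..<m})) \<le> card ({l, m mod n} \<times> {1..(d - 1) div 2})"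
    by (intro surj_card_le) auto
  also have "\<dots> \<le> 2 * ((d - 1) div 2)"
    by (auto simp: card_cartesian_product card_insert_if)
  also have "\<dots> \<le> d - 1"
    by simp
  finally show ?thesis .
qed

section \<open>Excluding the immersion\<close>

lemma no_clique_in_copy:
  assumes "clique_immersion H X Q" "card X = d" "P \<in> \<C>" "X \<subseteq> verts P"
  shows False
proof -
  interpret clique_immersion H X Q
    by (fact assms(1))
  obtain y y' where y: "y \<noteq> y'" "y \<in> low_verts d P" "y' \<in> low_verts d P"
    and adj: "\<And>q. q \<in> low_verts d P \<Longrightarrow> q \<noteq> y \<Longrightarrow> {y, q} \<in> edges P"
      "\<And>q. q \<in> low_verts d P \<Longrightarrow> q \<noteq> y' \<Longrightarrow> {y', q} \<in> edges P"
    using copy_structure(7)[OF assms(3)] by blast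
  have sub: "edges P \<subseteq> edges H"
    using assms(3) unfolding edges_H by blast
  show False
  \<comment> \<open>A copy has \<open>d + 1\<close> vertices, one more than \<open>X\<close>; its
    cut has five edges, an odd number; its low vertices have degree exactly \<open>d - 1\<close> in
    \<open>H\<close>.\<close>
  proof (rule no_clique_in_gadget[of "verts P" "low_verts d P" f y y'])
    show "finite (verts P)" "card (verts P) = card X + 1"
      using copy_structure(1,2) assms(2,3) by auto
    show "odd (card (low_verts d P))"
      using copy_structure(4)[OF assms(3)] by simp
    show "{y, q} \<in> edges H" if "q \<in> low_verts d P" "q \<noteq> y" for q
      using adj(1)[OF that] sub by blast
    show "{y', q} \<in> edges H" if "q \<in> low_verts d P" "q \<noteq> y'" for q
      using adj(2)[OF that] sub by blast
    show "degree H u \<le> card X" if "u \<in> verts P" for u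
      using degree_copy_bounds(2)[OF assms(3) that] assms(2) by simp
    show "degree H u = card X - 1" if "u \<in> low_verts d P" for u
      using degree_low[OF assms(3) that] assms(2) by simp
    show "f w \<notin> verts P" if "w \<in> low_verts d P" for w
      using attach_not_in_copy assms(3) that by blast
  qed (fact y assms(4) low_subset boundary_copy[OF assms(3)])+
qed

lemma no_clique_immersion:
  assumes "clique_immersion H X Q" "X \<subseteq> verts H" "card X = d"
  shows False
proof -
  interpret clique_immersion H X Q
    by (fact assms(1))
  have split: "card (X \<inter> S) + card (X - S) = d" for S
    using card_Int_Diff[OF finite_branch] assms(3) by simp
  have no_copy: "X \<inter> verts P = {}" if P: "P \<in> \<C>" for P
  proof (rule ccontr)
    assume "X \<inter> verts P \<noteq> {}"
    then have pos: "1 \<le> card (X \<inter> verts P)"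
      using finite_branch by (simp add: Suc_le_eq card_gt_0_iff)
    have "\<not> X \<subseteq> verts P"
      using no_clique_in_copy[OF assms(1,3) P] by blast
    then have pos': "1 \<le> card (X - verts P)"
      using finite_branch by (auto simp: Suc_le_eq card_gt_0_iff)
    have "finite (low_verts d P)"
      using copy_structure(4)[OF P] by (intro card_ge_0_finite) simp
    then have "card (boundary H (verts P)) \<le> 5"
      using boundary_copy[OF P] copy_structure(4)[OF P] card_image_le by metis
    then have "card (X \<inter> verts P) * card (X - verts P) \<le> 5"
      using cut_bound[of "verts P"] by linarith
    \<comment> \<open>For \<open>s = p + 1\<close> and \<open>d - s = q + 1\<close> the product is
      \<open>p * q + d - 1\<close>, and \<open>d - 1\<close> is at least 7, above the five cut
      edges.\<close>
    moreover have "d - 1 \<le> card (X \<inter> verts P) * card (X - verts P)"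
    proof -
      obtain p q where "card (X \<inter> verts P) = Suc p" "card (X - verts P) = Suc q"
        using pos pos' by (metis One_nat_def Suc_le_D)
      then show ?thesis
        using split[of "verts P"] by simp
    qed
    ultimately show False
      using d_ge by linarith
  qed
  have arc: "card (X \<inter> region {l..<m}) \<le> 1 \<or> d - 1 \<le> card (X \<inter> region {l..<m})"
    if lm: "l < m" "m \<le> n" for l m
  proof (rule ccontr)
    assume "\<not> ?thesis"
    then have "2 \<le> card (X \<inter> region {l..<m})" "2 \<le> card (X - region {l..<m})"
      using split[of "region {l..<m}"] by linarith+
    then obtain p q where "card (X \<inter> region {l..<m}) = 2 + p" "card (X - region {l..<m}) = 2 + q"
      using le_Suc_ex by metis
    \<comment> \<open>Since \<open>p + q = d - 4\<close>, the product is
      \<open>2 * d - 4 + p * q\<close>, which exceeds \<open>d - 1\<close>.\<close>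
    then show False
      using split[of "region {l..<m}"] cut_bound[of "region {l..<m}"] card_boundary_arc[OF lm]
      by (simp add: algebra_simps)
  qed
  \<comment> \<open>With no branch vertex in a copy, the count is at most \<open>d - 2\<close>,
    which rules out the large alternative of \<open>arc\<close>.\<close>
  have single: "card (X \<inter> region {m..<Suc m}) \<le> 1" if "m < n" for m
  proof -
    have "X \<inter> region {m..<Suc m} \<subseteq> bay d a m"
      using no_copy unfolding region_def by auto
    then have "card (X \<inter> region {m..<Suc m}) \<le> card (bay d a m)"
      by (intro card_mono) (auto simp: bay_def)
    also have "\<dots> \<le> d - 2"
      by (rule card_bay_le)
    finally show ?thesis
      using arc[of m "Suc m"] that d_ge by linarith
  qed
  have "card (X \<inter> region {0..<m}) \<le> 1" if "m \<le> n" for m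
    using that
  proof (induction m)
    case 0
    then show ?case
      by (simp add: region_def)
  next
    case (Suc m)
    have "region {0..<Suc m} = region {0..<m} \<union> region {m..<Suc m}"
      unfolding region_def by (auto simp: less_Suc_eq)
    then have "card (X \<inter> region {0..<Suc m}) \<le>
        card (X \<inter> region {0..<m}) + card (X \<inter> region {m..<Suc m})"
      by (simp add: Int_Un_distrib card_Un_le)
    \<comment> \<open>A count of at most 2 is below \<open>d - 1\<close>, so \<open>arc\<close>
      brings it back to at most 1.\<close>
    then have "card (X \<inter> region {0..<Suc m}) \<le> 2"
      using Suc single[of m] by simp
    then show ?case
      using arc[of 0 "Suc m"] Suc.prems d_ge by linarith
  qed
  then have "card (X \<inter> region {0..<n}) \<le> 1"
    by simp
  moreover have "verts H \<subseteq> region {0..<n}"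
    using home(1) unfolding verts_H region_def atLeast0LessThan by blast
  then have "X \<inter> region {0..<n} = X"
    using assms(2) by blast
  ultimately show False
    using assms(3) d_ge by simp
qed

end

lemma is_H5E:
  assumes "is_H5 d n H" "8 \<le> d" "1 \<le> n"
  obtains a \<C> f where "H5_graph d n a \<C> f H"
proof -
  obtain a \<C> f where
    inj: "inj_on (\<lambda>(i, j). a i j) ({..<n} \<times> {1..d - 2})" and
    fin: "finite \<C>" and
    copy: "\<forall>P\<in>\<C>. is_P5 d P" and
    disj: "\<forall>P\<in>\<C>. \<forall>Q\<in>\<C>. P \<noteq> Q \<longrightarrow> verts P \<inter> verts Q = {}" and
    bay: "\<forall>P\<in>\<C>. \<forall>i<n. verts P \<inter> bay d a i = {}" and
    att: "\<forall>P\<in>\<C>. \<exists>i<n. \<forall>w\<in>low_verts d P. f w \<in> bay d a i" and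
    verts: "verts H = (\<Union>i<n. bay d a i) \<union> (\<Union>P\<in>\<C>. verts P)" and
    edges: "edges H = (\<Union>i<n. edges (complete_graph (bay d a i))) \<union> bay_links d n a \<union>
      (\<Union>P\<in>\<C>. edges P \<union> {{w, f w} | w. w \<in> low_verts d P})" and
    deg: "\<forall>i<n. \<forall>x\<in>bay d a i. d - 1 \<le> degree H x"
    using assms(1) unfolding is_H5_def by (elim exE conjE) (rule that)
  have "H5_graph d n a \<C> f H"
    by (rule H5_graph.intro[OF assms(2,3) inj fin bspec[OF copy] disj[rule_format] bay[rule_format]
          bspec[OF att] verts edges deg[rule_format]])
  then show thesis
    by (rule that)
qed

theorem theorem4p17:
  fixes d n :: nat and H :: "'a graph"
  assumes "d \<ge> 8" and "n \<ge> 1"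
    and "is_H5 d n H"
  shows "min_degree H = d - 1 \<and> \<not> immersed (complete_graph {..<d}) H"
proof -
  obtain a \<C> f where "H5_graph d n a \<C> f H"
    using is_H5E[OF assms(3,1,2)] .
  then interpret H5_graph d n a \<C> f H .
  have "\<not> immersed (complete_graph {..<d}) H"
    using immersed_complete_graphE[of "{..<d}" H] finite_edges no_clique_immersion
    by (metis card_lessThan finite_lessThan)
  then show ?thesis
    using min_degree_eq by blast
qed

end
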